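(* Assume that $X=(W,Q,\pi,I)\in\mathscr D_{fin}$ with $\pi=w_0$ (the longest element of $W$) is flipped to $Y=(W,Q,\pi,(I\setminus\{i\})\cup\{i'\})$ by the flat $\{i,i'\}$ for a special vertex $i$ of $\Gamma_X$. Then $\Gamma_Y$ is obtained from $\Gamma_X$ by reversing all arrows adjacent to $i$ and relabeling the vertex $i$ of $\Gamma_X$ by $i'$.
   Context: Quadruples. For a Coxeter group $W$ of finite rank with simple reflections $s_1,\dots,s_n$, let $V$ be the real vector space with basis the simple roots $\alpha_1,\dots,\alpha_n$, with the form $\langle\alpha_i,\alpha_j\rangle=-\cos(\pi/\operatorname{ord}(s_is_j))$ and the usual geometric action of $W$. Write $[m]=\{1,\dots,m\}$. For a word $Q=s_{i_1}\cdots s_{i_m}$ and $\pi\in W$, the subword complex $\mathcal{SC}_W(Q,\pi)$ has as faces the subsets $I\subseteq[m]$ such that the subword of $Q$ at positions $[m]\setminus I$ contains a reduced expression of $\pi$. A quadruple is $X=(W,Q,\pi,I)$ with $I$ a maximal face of $\mathcal{SC}_W(Q,\pi)$. The root function is $r_X(l)=\big(\prod_{j\in[l-1]\setminus I}s_{i_j}\big)(\alpha_{i_l})$, $l\in[m]$ (product in increasing order of $j$). $X$ is irreducible if $\{r_X(i)\}_{i\in I}$ spans $V$; it is moreover root independent if $\{r_X(i)\}_{i\in I}$ is a basis of $V$. $\mathscr D_{fin}$ consists of the root independent irreducible quadruples with $W$ finite. Root configuration quiver. $\Gamma_X$ has vertex set (labelled by) $I$, and there is a (single) arrow $i\to j$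 if and only if $(i-j)\cdot\langle r_X(i),r_X(j)\rangle>0$. Flips. The flat of a subspace $U\subseteq V$ is $\{l\in[m]:r_X(l)\in U\}$. For $i\in I$, $i'$ denotes the unique index in $[m]\setminus I$ such that $\{i,i'\}$ is a flippable flat of $X$, i.e. such that $\{i,i'\}$ is the flat of the line $\mathbb R r_X(i)$. The flip of $X$ by $\{i,i'\}$ replaces the maximal face $I$ by $(I\setminus\{i\})\cup\{i'\}$. The reflection interval of the flip is $[i,i']$ if $i<i'$ and $[i',i]$ if $i'<i$; the stable interval is its complement in $[m]$. A vertex $i$ of $\Gamma_X$ is special if the vertices adjacent to $i$ in $\Gamma_X$ are either all in the reflection interval or all in the stable interval of the flip $\{i,i'\}$. *)

theory Defs
  imports
    "HOL-Analysis.Analysis"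
    "HOL-Algebra.Multiplicative_Group"
    "HOL-Algebra.Generated_Groups"
    "HOL-Library.Sublist"
    "Graph_Theory.Pair_Digraph"
begin

section \<open>Coxeter groups\<close>

text \<open>
  A Coxeter group is a group \<open>W\<close> together with its family \<open>s\<close> of simple reflections, indexed
  by a finite type. Words in the simple reflections are lists of indices.
\<close>

definition cox_ord :: "('g, 'b) monoid_scheme \<Rightarrow> ('n \<Rightarrow> 'g) \<Rightarrow> 'n \<Rightarrow> 'n \<Rightarrow> nat" where
  "cox_ord W s i j = group.ord W (s i \<otimes>\<^bsub>W\<^esub> s j)"

definition word_prod :: "('g, 'b) monoid_scheme \<Rightarrow> ('n \<Rightarrow> 'g) \<Rightarrow> 'n list \<Rightarrow> 'g" where
  "word_prod W s u = foldr (\<lambda>i x. s i \<otimes>\<^bsub>W\<^esub> x) u \<one>\<^bsub>W\<^esub>"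

text \<open>
  The congruence on words generated by the Coxeter relations, i.e. the word \<open>i j i j \<dots>\<close> with
  \<open>cox_ord W s i j\<close> repetitions of \<open>i j\<close> is trivial. The order is \<open>0\<close> if \<open>s i s j\<close> has infinite
  order, and then the relation is void. Since the case \<open>i = j\<close> makes every generator its own
  inverse, this monoid congruence is the one of the group presentation.
\<close>

inductive cox_eq :: "('g, 'b) monoid_scheme \<Rightarrow> ('n \<Rightarrow> 'g) \<Rightarrow> 'n list \<Rightarrow> 'n list \<Rightarrow> bool"
  for W s where
  cox_rel: "cox_eq W s (concat (replicate (cox_ord W s i j) [i, j])) []"
| cox_refl: "cox_eq W s u u"
| cox_sym: "cox_eq W s u v \<Longrightarrow> cox_eq W s v u"
| cox_trans: "cox_eq W s u v \<Longrightarrow> cox_eq W s v w \<Longrightarrow> cox_eq W s u w"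
| cox_append: "cox_eq W s u v \<Longrightarrow> cox_eq W s u' v' \<Longrightarrow> cox_eq W s (u @ u') (v @ v')"

text \<open>
  The simple reflections are distinct involutions generating \<open>W\<close>, and the last conjunct says
  that \<open>W\<close> is presented by the generators \<open>s i\<close> and the relations \<open>(s i s j)^ord(s i s j) = 1\<close>.
\<close>

definition coxeter_system :: "('g, 'b) monoid_scheme \<Rightarrow> ('n::finite \<Rightarrow> 'g) \<Rightarrow> bool" where
  "coxeter_system W s \<longleftrightarrow>
     group W \<and> inj s \<and> range s \<subseteq> carrier W \<and>
     (\<forall>i. group.ord W (s i) = 2) \<and>
     generate W (range s) = carrier W \<and>
     (\<forall>u v. word_prod W s u = word_prod W s v \<longleftrightarrow> cox_eq W s u v)"

definition cox_length :: "('g, 'b) monoid_scheme \<Rightarrow> ('n \<Rightarrow> 'g) \<Rightarrow> 'g \<Rightarrow> nat" where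
  "cox_length W s w = (LEAST k. \<exists>u. word_prod W s u = w \<and> length u = k)"

definition reduced_expression :: "('g, 'b) monoid_scheme \<Rightarrow> ('n \<Rightarrow> 'g) \<Rightarrow> 'n list \<Rightarrow> 'g \<Rightarrow> bool" where
  "reduced_expression W s u w \<longleftrightarrow> word_prod W s u = w \<and> length u = cox_length W s w"

definition longest_element :: "('g, 'b) monoid_scheme \<Rightarrow> ('n \<Rightarrow> 'g) \<Rightarrow> 'g \<Rightarrow> bool" where
  "longest_element W s w \<longleftrightarrow>
     w \<in> carrier W \<and> (\<forall>v\<in>carrier W. cox_length W s v \<le> cox_length W s w)"


section \<open>The geometric representation\<close>

definition simple_root :: "'n::finite \<Rightarrow> real ^ 'n" where
  "simple_root i = axis i 1"

text \<open>
  If \<open>s i s j\<close> has infinite order, then \<open>pi / 0 = 0\<close> yields the conventional value \<open>- 1\<close>.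
\<close>

definition cox_form ::
  "('g, 'b) monoid_scheme \<Rightarrow> ('n::finite \<Rightarrow> 'g) \<Rightarrow> real ^ 'n \<Rightarrow> real ^ 'n \<Rightarrow> real" where
  "cox_form W s x y =
     (\<Sum>i\<in>UNIV. \<Sum>j\<in>UNIV. x $ i * y $ j * (- cos (pi / real (cox_ord W s i j))))"

definition simple_reflection ::
  "('g, 'b) monoid_scheme \<Rightarrow> ('n::finite \<Rightarrow> 'g) \<Rightarrow> 'n \<Rightarrow> real ^ 'n \<Rightarrow> real ^ 'n" where
  "simple_reflection W s i v = v - (2 * cox_form W s v (simple_root i)) *\<^sub>R simple_root i"

text \<open>
  The geometric action of the product of a word: the composition of the actions of its letters,
  the last letter acting first.
\<close>

definition word_action ::
  "('g, 'b) monoid_scheme \<Rightarrow> ('n::finite \<Rightarrow> 'g) \<Rightarrow> 'n list \<Rightarrow> real ^ 'n \<Rightarrow> real ^ 'n" where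
  "word_action W s u = foldr (simple_reflection W s) u"


section \<open>Subword complexes and quadruples\<close>

text \<open>
  Positions in a word \<open>Q\<close> are counted from \<open>0\<close>, so \<open>[m]\<close> becomes \<open>{..<length Q}\<close>;
  \<open>nths Q (- I)\<close> is the subword of \<open>Q\<close> at the positions outside \<open>I\<close>.
\<close>

definition subword_complex ::
  "('g, 'b) monoid_scheme \<Rightarrow> ('n \<Rightarrow> 'g) \<Rightarrow> 'n list \<Rightarrow> 'g \<Rightarrow> nat set set" where
  "subword_complex W s Q \<pi> =
     {I. I \<subseteq> {..<length Q} \<and> (\<exists>u. subseq u (nths Q (- I)) \<and> reduced_expression W s u \<pi>)}"

definition quadruple ::
  "('g, 'b) monoid_scheme \<Rightarrow> ('n::finite \<Rightarrow> 'g) \<Rightarrow> 'n list \<Rightarrow> 'g \<Rightarrow> nat set \<Rightarrow> bool" where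
  "quadruple W s Q \<pi> I \<longleftrightarrow>
     coxeter_system W s \<and> \<pi> \<in> carrier W \<and>
     I \<in> subword_complex W s Q \<pi> \<and> (\<forall>J\<in>subword_complex W s Q \<pi>. I \<subseteq> J \<longrightarrow> J = I)"

definition root_function ::
  "('g, 'b) monoid_scheme \<Rightarrow> ('n::finite \<Rightarrow> 'g) \<Rightarrow> 'n list \<Rightarrow> nat set \<Rightarrow> nat \<Rightarrow> real ^ 'n" where
  "root_function W s Q I l = word_action W s (nths (take l Q) (- I)) (simple_root (Q ! l))"

definition irreducible_quadruple ::
  "('g, 'b) monoid_scheme \<Rightarrow> ('n::finite \<Rightarrow> 'g) \<Rightarrow> 'n list \<Rightarrow> nat set \<Rightarrow> bool" where
  "irreducible_quadruple W s Q I \<longleftrightarrow> span (root_function W s Q I ` I) = UNIV"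

text \<open>
  A basis is meant for the family of roots indexed by \<open>I\<close>, so repetitions are excluded.
\<close>

definition root_independent ::
  "('g, 'b) monoid_scheme \<Rightarrow> ('n::finite \<Rightarrow> 'g) \<Rightarrow> 'n list \<Rightarrow> nat set \<Rightarrow> bool" where
  "root_independent W s Q I \<longleftrightarrow>
     inj_on (root_function W s Q I) I \<and>
     independent (root_function W s Q I ` I) \<and> span (root_function W s Q I ` I) = UNIV"

definition D_fin ::
  "('g, 'b) monoid_scheme \<Rightarrow> ('n::finite \<Rightarrow> 'g) \<Rightarrow> 'n list \<Rightarrow> 'g \<Rightarrow> nat set \<Rightarrow> bool" where
  "D_fin W s Q \<pi> I \<longleftrightarrow>
     quadruple W s Q \<pi> I \<and> irreducible_quadruple W s Q I \<and> root_independent W s Q I \<and>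
     finite (carrier W)"


section \<open>Root configuration quivers\<close>

definition root_quiver ::
  "('g, 'b) monoid_scheme \<Rightarrow> ('n::finite \<Rightarrow> 'g) \<Rightarrow> 'n list \<Rightarrow> nat set \<Rightarrow> nat pair_pre_digraph" where
  "root_quiver W s Q I =
     \<lparr> pverts = I,
       parcs = {(i, j). i \<in> I \<and> j \<in> I \<and>
         (real i - real j) * cox_form W s (root_function W s Q I i) (root_function W s Q I j) > 0} \<rparr>"

definition adjacent_vertices :: "'v pair_pre_digraph \<Rightarrow> 'v \<Rightarrow> 'v set" where
  "adjacent_vertices G v = {w. (v, w) \<in> parcs G \<or> (w, v) \<in> parcs G}"

definition reverse_arcs_at :: "'v \<Rightarrow> 'v pair_pre_digraph \<Rightarrow> 'v pair_pre_digraph" where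
  "reverse_arcs_at v G =
     \<lparr> pverts = pverts G,
       parcs = {(a, b). if a = v \<or> b = v then (b, a) \<in> parcs G else (a, b) \<in> parcs G} \<rparr>"

definition relabel :: "('v \<Rightarrow> 'w) \<Rightarrow> 'v pair_pre_digraph \<Rightarrow> 'w pair_pre_digraph" where
  "relabel f G = \<lparr> pverts = f ` pverts G, parcs = map_prod f f ` parcs G \<rparr>"


section \<open>Flips\<close>

definition flat ::
  "('g, 'b) monoid_scheme \<Rightarrow> ('n::finite \<Rightarrow> 'g) \<Rightarrow> 'n list \<Rightarrow> nat set \<Rightarrow> (real ^ 'n) set \<Rightarrow> nat set" where
  "flat W s Q I U = {l. l < length Q \<and> root_function W s Q I l \<in> U}"

definition flippable_flat ::
  "('g, 'b) monoid_scheme \<Rightarrow> ('n::finite \<Rightarrow> 'g) \<Rightarrow> 'n list \<Rightarrow> nat set \<Rightarrow> nat \<Rightarrow> nat \<Rightarrow> bool" where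
  "flippable_flat W s Q I i i' \<longleftrightarrow>
     i \<in> I \<and> i' \<in> {..<length Q} - I \<and> flat W s Q I (span {root_function W s Q I i}) = {i, i'}"

definition flip :: "nat set \<Rightarrow> nat \<Rightarrow> nat \<Rightarrow> nat set" where
  "flip I i i' = (I - {i}) \<union> {i'}"

definition reflection_interval :: "nat \<Rightarrow> nat \<Rightarrow> nat set" where
  "reflection_interval i i' = {min i i'..max i i'}"

definition stable_interval :: "'n list \<Rightarrow> nat \<Rightarrow> nat \<Rightarrow> nat set" where
  "stable_interval Q i i' = {..<length Q} - reflection_interval i i'"

definition special_vertex ::
  "('g, 'b) monoid_scheme \<Rightarrow> ('n::finite \<Rightarrow> 'g) \<Rightarrow> 'n list \<Rightarrow> nat set \<Rightarrow> nat \<Rightarrow> nat \<Rightarrow> bool" where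
  "special_vertex W s Q I i i' \<longleftrightarrow>
     adjacent_vertices (root_quiver W s Q I) i \<subseteq> reflection_interval i i' \<or>
     adjacent_vertices (root_quiver W s Q I) i \<subseteq> stable_interval Q i i'"

end

theory Submission
  imports Defs
begin

text \<open>
  Write \<open>J\<close> for the flipped facet \<open>(I - {i}) \<union> {i'}\<close>, \<open>r\<close> and \<open>r'\<close> for the root functions of \<open>I\<close> and
  \<open>J\<close>, and \<open>\<beta>\<close> for the root \<open>r i\<close>.

  Adding a letter to a word multiplies it by a conjugate of a simple reflection, that is, by the
  reflection along a root. Passing from \<open>I\<close> to \<open>J\<close> adds the letter at \<open>i\<close> and deletes the letter at
  \<open>i'\<close>. Since \<open>{i, i'}\<close> is a flat, the roots of both positions span the same line and both changes
  act as the reflection along \<open>\<beta>\<close>. So \<open>r'\<close> is the image of \<open>r\<close> under this reflection between the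
  two positions, and \<open>r'\<close> agrees with \<open>r\<close> elsewhere; see \<open>flip_root_function\<close>.

  If \<open>i\<close> is special, then on one of the two sides, the reflection interval or the stable interval,
  all roots of \<open>I - {i}\<close> are orthogonal to \<open>\<beta>\<close>, hence fixed by the reflection. Therefore all of
  \<open>I - {i}\<close> is transformed by one and the same isometry (\<open>special_flip_root_function\<close>), and the
  arrows away from \<open>i\<close> do not change. The root of the new vertex \<open>i'\<close> is \<open>- \<beta>\<close>. If the common
  isometry is the identity, the form values at the flipped vertex change sign, while the neighbours,
  lying in the stable interval, are on the same side of \<open>i\<close> and \<open>i'\<close>. If it is the reflection, it
  maps \<open>\<beta>\<close> to \<open>- \<beta>\<close>, so the form values do not change, but the neighbours lie between \<open>i\<close> and
  \<open>i'\<close>. In both cases each arrow at the flipped vertex is reversed.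

  What remains is that the root of \<open>i'\<close> is \<open>- \<beta>\<close> and not \<open>\<beta>\<close>. The sign is decided by the
  positivity of roots: if \<open>u a\<close> is a reduced word, then \<open>u\<close> maps the simple root of \<open>a\<close> to a
  nonnegative combination of simple roots (\<open>reduced_snoc_root_nonneg\<close>). This applies because the
  complement of a facet is a reduced word. Its proof is the classical induction on the length that
  reduces to the dihedral subgroup of two generators, where the action is an explicit rotation
  formula. The same formula shows that the geometric action respects the Coxeter relations.
\<close>

section \<open>The Coxeter form and its reflections\<close>

locale coxeter =
  fixes W :: "('g, 'b) monoid_scheme" and s :: "'n::finite \<Rightarrow> 'g"
  assumes coxeter_system: "coxeter_system W s"
begin

abbreviation form :: "real ^ 'n \<Rightarrow> real ^ 'n \<Rightarrow> real" where
  "form \<equiv> cox_form W s"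

abbreviation act :: "'n list \<Rightarrow> real ^ 'n \<Rightarrow> real ^ 'n" where
  "act \<equiv> word_action W s"

abbreviation congruent_words :: "'n list \<Rightarrow> 'n list \<Rightarrow> bool"  (infix "\<simeq>" 50) where
  "u \<simeq> v \<equiv> cox_eq W s u v"

definition reflection_along :: "real ^ 'n \<Rightarrow> real ^ 'n \<Rightarrow> real ^ 'n" where
  "reflection_along \<beta> v = v - (2 * form v \<beta>) *\<^sub>R \<beta>"

lemma group_W: "group W"
  using coxeter_system by (simp add: coxeter_system_def)

lemma generator_closed: "s a \<in> carrier W"
  using coxeter_system by (auto simp: coxeter_system_def)

lemma generator_involutive: "s a \<otimes>\<^bsub>W\<^esub> s a = \<one>\<^bsub>W\<^esub>"
proof -
  interpret group W by (rule group_W)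
  have "group.ord W (s a) = 2"
    using coxeter_system by (auto simp: coxeter_system_def)
  then have "s a [^]\<^bsub>W\<^esub> (2::nat) = \<one>\<^bsub>W\<^esub>"
    using pow_ord_eq_1[OF generator_closed[of a]] by simp
  then show ?thesis
    using generator_closed by (simp add: numeral_2_eq_2)
qed

lemma generator_inv: "inv\<^bsub>W\<^esub> (s a) = s a"
proof -
  interpret group W by (rule group_W)
  show ?thesis
    using generator_closed generator_involutive by (simp add: inv_equality)
qed

lemma cox_ord_same: "cox_ord W s a a = 1"
proof -
  interpret group W by (rule group_W)
  show ?thesis by (simp add: cox_ord_def generator_involutive)
qed

lemma cox_ord_commute: "cox_ord W s a b = cox_ord W s b a"
proof -
  interpret group W by (rule group_W)
  have "inv\<^bsub>W\<^esub> (s a \<otimes>\<^bsub>W\<^esub> s b) = s b \<otimes>\<^bsub>W\<^esub> s a"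
    by (simp add: inv_mult_group generator_closed generator_inv)
  then show ?thesis
    unfolding cox_ord_def by (metis generator_closed m_closed ord_inv)
qed

lemma cox_ord_neq_1:
  assumes "a \<noteq> b"
  shows "cox_ord W s a b \<noteq> 1"
proof
  interpret group W by (rule group_W)
  assume "cox_ord W s a b = 1"
  then have "s a \<otimes>\<^bsub>W\<^esub> s b = \<one>\<^bsub>W\<^esub>"
    unfolding cox_ord_def
    by (metis generator_closed m_closed nat_pow_eone pow_ord_eq_1)
  then have "s a = s b"
    by (metis generator_closed generator_inv inv_equality)
  then show False
    using coxeter_system assms by (auto simp: coxeter_system_def inj_eq)
qed

lemma form_add_left: "form (x + y) z = form x z + form y z"
  by (simp add: cox_form_def distrib_right sum.distrib sum_negf sum_subtractf)

lemma form_scale_left: "form (c *\<^sub>R x) z = c * form x z"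
  by (simp add: cox_form_def sum_distrib_left algebra_simps)

lemma form_commute: "form x y = form y x"
proof -
  have "form x y =
      (\<Sum>j\<in>UNIV. \<Sum>i\<in>UNIV. x $ i * y $ j * (- cos (pi / real (cox_ord W s i j))))"
    unfolding cox_form_def by (rule sum.swap)
  also have "\<dots> = form y x"
    unfolding cox_form_def
    by (intro sum.cong refl) (simp add: cox_ord_commute mult_ac)
  finally show ?thesis .
qed

lemma form_add_right: "form z (x + y) = form z x + form z y"
  by (metis form_add_left form_commute)

lemma form_scale_right: "form z (c *\<^sub>R x) = c * form z x"
  by (metis form_scale_left form_commute)

lemma form_minus_left: "form (- x) z = - form x z"
  using form_scale_left[of "-1" x z] by simp

lemma form_minus_right: "form z (- x) = - form z x"
  using form_scale_right[of z "-1" x] by simp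

lemma form_diff_left: "form (x - y) z = form x z - form y z"
  using form_add_left[of x "- y" z] by (simp add: form_minus_left)

lemma form_diff_right: "form z (x - y) = form z x - form z y"
  using form_add_right[of z x "- y"] by (simp add: form_minus_right)

lemmas form_linear =
  form_add_left form_add_right form_diff_left form_diff_right
  form_minus_left form_minus_right form_scale_left form_scale_right

lemma form_simple_roots:
  "form (simple_root a) (simple_root b) = - cos (pi / real (cox_ord W s a b))"
proof -
  let ?c = "\<lambda>i j. - cos (pi / real (cox_ord W s i j))"
  have "simple_root a $ i * simple_root b $ j * ?c i j =
      (if j = b then (if i = a then ?c i j else 0) else 0)" for i j
    by (simp add: simple_root_def axis_def)
  then show ?thesis
    by (simp add: cox_form_def del: mult_minus_right)
qed

lemma form_simple_root_self: "form (simple_root a) (simple_root a) = 1"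
  by (simp add: form_simple_roots cox_ord_same)

lemma simple_reflection_eq: "simple_reflection W s a = reflection_along (simple_root a)"
  by (simp add: fun_eq_iff simple_reflection_def reflection_along_def)

lemma linear_reflection_along: "linear (reflection_along \<beta>)"
  by (rule linearI) (simp_all add: reflection_along_def form_linear algebra_simps)

lemma reflection_along_self:
  assumes "form \<beta> \<beta> = 1"
  shows "reflection_along \<beta> \<beta> = - \<beta>"
proof -
  have "\<beta> - 2 *\<^sub>R \<beta> = - \<beta>"
    by (simp add: scaleR_2)
  then show ?thesis
    using assms by (simp add: reflection_along_def)
qed

lemma reflection_along_orthogonal: "form v \<beta> = 0 \<Longrightarrow> reflection_along \<beta> v = v"
  by (simp add: reflection_along_def)

lemma reflection_along_uminus: "reflection_along (- \<beta>) = reflection_along \<beta>"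
  by (simp add: fun_eq_iff reflection_along_def form_linear)

lemma form_reflection_along:
  assumes "form \<beta> \<beta> = 1"
  shows "form (reflection_along \<beta> x) (reflection_along \<beta> y) = form x y"
  using assms
  by (simp add: reflection_along_def form_linear form_commute[of \<beta> y] algebra_simps)

lemma reflection_along_involutive:
  assumes "form \<beta> \<beta> = 1"
  shows "reflection_along \<beta> (reflection_along \<beta> v) = v"
  using assms by (simp add: reflection_along_def form_linear algebra_simps)

lemma act_Nil [simp]: "act [] v = v"
  by (simp add: word_action_def)

lemma act_Cons: "act (a # u) v = reflection_along (simple_root a) (act u v)"
  by (simp add: word_action_def simple_reflection_eq)

lemma act_append: "act (u @ v) x = act u (act v x)"
  by (simp add: word_action_def)

lemma act_singleton: "act [a] v = reflection_along (simple_root a) v"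
  by (simp add: act_Cons)

lemma linear_act: "linear (act u)"
proof (induction u)
  case Nil
  show ?case by (rule linearI) simp_all
next
  case (Cons a u)
  then have "linear (reflection_along (simple_root a) \<circ> act u)"
    by (intro linear_compose linear_reflection_along)
  then show ?case
    by (simp add: o_def flip: act_Cons)
qed

lemma form_act: "form (act u x) (act u y) = form x y"
  by (induction u)
    (simp_all add: act_Cons form_reflection_along form_simple_root_self)

lemma act_rev_cancel: "act (rev u) (act u v) = v"
  by (induction u arbitrary: v)
    (simp_all add: act_append act_Cons reflection_along_involutive form_simple_root_self)

text \<open>
  Conjugating a simple reflection by a word gives the reflection along the transported simple
  root. This is what turns inserting or deleting a letter of a word into applying one reflection.
\<close>

lemma act_snoc: "act (u @ [a]) v = reflection_along (act u (simple_root a)) (act u v)"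
proof -
  have "act u (reflection_along (simple_root a) v) =
      act u v - (2 * form v (simple_root a)) *\<^sub>R act u (simple_root a)"
    by (simp add: reflection_along_def linear_diff[OF linear_act] linear_scale[OF linear_act])
  then show ?thesis
    by (simp add: act_append act_singleton reflection_along_def form_act)
qed


section \<open>The rank two calculation\<close>

text \<open>The last letter of a word acts first, so the recursion pins down the last letter, \<open>a\<close>.\<close>

fun alternating :: "nat \<Rightarrow> 'a \<Rightarrow> 'a \<Rightarrow> 'a list" where
  "alternating 0 a b = []"
| "alternating (Suc k) a b = alternating k b a @ [a]"

lemma length_alternating [simp]: "length (alternating k a b) = k"
  by (induction k arbitrary: a b) auto

lemma alternating_suffix: "\<exists>z. length z = j \<and> alternating (j + k) a b = z @ alternating k a b"
proof (induction k arbitrary: a b)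
  case (Suc k)
  then obtain z where "length z = j" "alternating (j + k) b a = z @ alternating k b a"
    by blast
  then show ?case by auto
qed simp

lemma alternating_even: "concat (replicate m [a, b]) = alternating (2 * m) b a"
proof (induction m)
  case (Suc m)
  have "concat (replicate (Suc m) [a, b]) = concat (replicate m [a, b]) @ [a, b]"
    by (metis concat.simps(1,2) concat_append replicate_Suc replicate_append_same self_append_conv)
  then show ?case
    using Suc by simp
qed simp

lemma distinct_adj_imp_alternating:
  assumes "distinct_adj (x @ [a])" "set x \<subseteq> {a, b}"
  shows "alternating (length x) b a = x"
  using assms
proof (induction x arbitrary: a b rule: rev_induct)
  case (snoc c x)
  then have "c = b" "distinct_adj (x @ [b])"
    by (auto simp: distinct_adj_append_iff)
  with snoc.prems snoc.IH[of b a] show ?case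
    by auto
qed simp

text \<open>
  A solution of the recurrence \<open>g (t + 2) = 2 cos (\<pi> / m) g (t + 1) - g t\<close> vanishing at \<open>0\<close>;
  for \<open>m = 0\<close>, which encodes an infinite order, the angle is \<open>0\<close> and it is linear.
\<close>

definition dihedral_coeff :: "nat \<Rightarrow> real \<Rightarrow> real" where
  "dihedral_coeff m t = (if m = 0 then t else sin (t * pi / real m))"

lemma dihedral_coeff_rec:
  "dihedral_coeff m (t + 2) = 2 * cos (pi / real m) * dihedral_coeff m (t + 1) - dihedral_coeff m t"
proof (cases "m = 0")
  case False
  define x where "x = (t + 1) * pi / real m"
  have "(t + 2) * pi / real m = x + pi / real m" "t * pi / real m = x - pi / real m"
    using False by (auto simp: x_def field_simps)
  then show ?thesis
    using False by (simp add: dihedral_coeff_def sin_add sin_diff flip: x_def)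
qed (simp add: dihedral_coeff_def)

lemma dihedral_coeff_nonneg:
  assumes "0 \<le> t" "m = 0 \<or> t \<le> real m"
  shows "0 \<le> dihedral_coeff m t"
proof (cases "m = 0")
  case False
  have "t * pi / real m \<le> pi"
    using assms False by (simp add: divide_le_eq mult.commute)
  then show ?thesis
    using assms False by (auto simp: dihedral_coeff_def intro!: sin_ge_zero)
qed (use assms in \<open>simp add: dihedral_coeff_def\<close>)

lemma dihedral_coeff_periodic:
  "m \<noteq> 0 \<Longrightarrow> dihedral_coeff m (t + real (2 * m)) = dihedral_coeff m t"
proof -
  assume "m \<noteq> 0"
  then have "(t + real (2 * m)) * pi / real m = t * pi / real m + 2 * pi"
    by (simp add: field_simps)
  then show ?thesis
    by (simp add: dihedral_coeff_def)
qed

lemma dihedral_coeff_1_pos: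
  assumes "m \<noteq> 1"
  shows "0 < dihedral_coeff m 1"
proof (cases "m = 0")
  case False
  with assms have "pi / real m < pi"
    by (simp add: divide_less_eq)
  then show ?thesis
    using False by (auto simp: dihedral_coeff_def intro!: sin_gt_zero)
qed (simp add: dihedral_coeff_def)

definition dihedral_vector :: "'n \<Rightarrow> 'n \<Rightarrow> real \<Rightarrow> real ^ 'n" where
  "dihedral_vector a b t =
     dihedral_coeff (cox_ord W s a b) (t + 1) *\<^sub>R simple_root a +
     dihedral_coeff (cox_ord W s a b) t *\<^sub>R simple_root b"

text \<open>
  In the plane of two distinct simple roots the vectors \<^term>\<open>dihedral_vector a b t\<close> lie on a circle (or,
  for infinite order, on a line), and a simple reflection moves such a vector one step further.
\<close>

lemma reflection_dihedral_vector:
  "reflection_along (simple_root b) (dihedral_vector a b t) = dihedral_vector b a (t + 1)"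
proof -
  let ?m = "cox_ord W s a b"
  have form: "form (dihedral_vector a b t) (simple_root b) =
      - cos (pi / real ?m) * dihedral_coeff ?m (t + 1) + dihedral_coeff ?m t"
    by (simp add: dihedral_vector_def form_linear form_simple_roots cox_ord_same)
  have "reflection_along (simple_root b) (dihedral_vector a b t) =
      dihedral_coeff ?m (t + 1) *\<^sub>R simple_root a +
      (2 * cos (pi / real ?m) * dihedral_coeff ?m (t + 1) - dihedral_coeff ?m t) *\<^sub>R simple_root b"
    unfolding reflection_along_def form
    by (simp add: dihedral_vector_def vec_eq_iff algebra_simps)
  also have "2 * cos (pi / real ?m) * dihedral_coeff ?m (t + 1) - dihedral_coeff ?m t =
      dihedral_coeff ?m (t + 1 + 1)"
    using dihedral_coeff_rec[of ?m t] by (simp add: add.assoc)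
  finally show ?thesis
    by (simp add: dihedral_vector_def cox_ord_commute[of b a] add.commute)
qed

lemma act_alternating_dihedral_vector:
  "act (alternating k b a) (dihedral_vector a b t) =
     (if even k then dihedral_vector a b (t + real k) else dihedral_vector b a (t + real k))"
  by (induction k arbitrary: a b t)
    (simp_all add: act_append act_singleton reflection_dihedral_vector add_ac)

lemma dihedral_vector_0:
  "dihedral_vector a b 0 = dihedral_coeff (cox_ord W s a b) 1 *\<^sub>R simple_root a"
  by (simp add: dihedral_vector_def dihedral_coeff_def)

lemma dihedral_vector_minus_1:
  "dihedral_vector a b (-1) = - dihedral_coeff (cox_ord W s a b) 1 *\<^sub>R simple_root b"
  by (simp add: dihedral_vector_def dihedral_coeff_def)

text \<open>
  As long as an alternating word is shorter than the order of the product of its two letters, the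
  circle has not been run through far enough for a coefficient to become negative.
\<close>

lemma act_alternating_simple_root:
  assumes "a \<noteq> b" "cox_ord W s a b = 0 \<or> k < cox_ord W s a b"
  shows "\<exists>c d. 0 \<le> c \<and> 0 \<le> d \<and>
    act (alternating k b a) (simple_root a) = c *\<^sub>R simple_root a + d *\<^sub>R simple_root b"
proof -
  let ?g = "dihedral_coeff (cox_ord W s a b)"
  have pos: "0 < ?g 1"
    using dihedral_coeff_1_pos cox_ord_neq_1[OF assms(1)] by blast
  then have "simple_root a = inverse (?g 1) *\<^sub>R dihedral_vector a b 0"
    by (simp add: dihedral_vector_0)
  then have "act (alternating k b a) (simple_root a) =
      inverse (?g 1) *\<^sub>R
        (if even k then dihedral_vector a b (real k) else dihedral_vector b a (real k))"
    using act_alternating_dihedral_vector[of k b a 0] linear_scale[OF linear_act] by simp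
  also have "\<dots> =
      (inverse (?g 1) * (if even k then ?g (real k + 1) else ?g (real k))) *\<^sub>R simple_root a +
      (inverse (?g 1) * (if even k then ?g (real k) else ?g (real k + 1))) *\<^sub>R simple_root b"
    by (simp add: dihedral_vector_def cox_ord_commute[of b a] scaleR_add_right add.commute)
  finally show ?thesis
    using assms(2) pos
    by (intro exI conjI) (auto intro!: mult_nonneg_nonneg dihedral_coeff_nonneg)
qed

lemma act_coxeter_relation:
  "act (concat (replicate (cox_ord W s a b) [a, b])) v = v"
proof (cases "a = b \<or> cox_ord W s a b = 0")
  case True
  then show ?thesis
    by (auto simp: cox_ord_same act_Cons reflection_along_involutive form_simple_root_self)
next
  case False
  define m where "m = cox_ord W s a b"
  define w where "w = concat (replicate m [a, b])"
  define c where "c = cos (pi / real m)"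
  have m: "m \<noteq> 0" "m \<noteq> 1" and ab: "a \<noteq> b"
    using False cox_ord_neq_1 by (auto simp: m_def)
  have w: "w = alternating (2 * m) b a"
    by (simp add: w_def alternating_even)
  have g: "dihedral_coeff m 1 \<noteq> 0"
    using dihedral_coeff_1_pos[OF m(2)] by simp
  have period: "act w (dihedral_vector a b t) = dihedral_vector a b t" for t
  proof -
    have "act w (dihedral_vector a b t) = dihedral_vector a b (t + real (2 * m))"
      unfolding w act_alternating_dihedral_vector by simp
    also have "\<dots> = dihedral_vector a b t"
      using dihedral_coeff_periodic[OF m(1), of t] dihedral_coeff_periodic[OF m(1), of "t + 1"]
      by (simp add: dihedral_vector_def add_ac flip: m_def)
    finally show ?thesis .
  qed
  have fix_a: "act w (simple_root a) = simple_root a"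
    using period[of 0] g
    by (simp add: dihedral_vector_0 linear_scale[OF linear_act] flip: m_def)
  have fix_b: "act w (simple_root b) = simple_root b"
    using period[of "-1"] g
    by (simp add: dihedral_vector_minus_1 linear_scale[OF linear_act]
        linear_neg[OF linear_act] flip: m_def)
  have fix_orthogonal: "act w x = x"
    if "form x (simple_root a) = 0" "form x (simple_root b) = 0" for x
  proof -
    have "act u x = x" if "set u \<subseteq> {a, b}" for u
      using that \<open>form x (simple_root a) = 0\<close> \<open>form x (simple_root b) = 0\<close>
      by (induction u) (auto simp: act_Cons reflection_along_orthogonal)
    moreover have "set w \<subseteq> {a, b}"
      by (auto simp: w_def)
    ultimately show ?thesis by blast
  qed
  have "0 < sin (pi / real m)"
    using dihedral_coeff_1_pos[OF m(2)] m(1) by (simp add: dihedral_coeff_def)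
  then have det: "1 - c\<^sup>2 \<noteq> 0"
    by (simp add: c_def cos_squared_eq)
  \<comment> \<open>The form is nondegenerate on the plane of the two roots, so \<open>v\<close> is a combination of them
    plus a vector orthogonal to both; Cramer's rule gives the coefficients.\<close>
  define p where "p = (form v (simple_root a) + c * form v (simple_root b)) / (1 - c\<^sup>2)"
  define q where "q = (form v (simple_root b) + c * form v (simple_root a)) / (1 - c\<^sup>2)"
  define x where "x = v - p *\<^sub>R simple_root a - q *\<^sub>R simple_root b"
  have forms: "form (simple_root a) (simple_root b) = - c" "form (simple_root b) (simple_root a) = - c"
    by (simp_all add: form_simple_roots c_def m_def cox_ord_commute[of b a])
  have pq: "p * (1 - c\<^sup>2) = form v (simple_root a) + c * form v (simple_root b)"
      "q * (1 - c\<^sup>2) = form v (simple_root b) + c * form v (simple_root a)"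
    using det by (simp_all add: p_def q_def)
  have "(p - c * q) * (1 - c\<^sup>2) = p * (1 - c\<^sup>2) - c * (q * (1 - c\<^sup>2))"
    by (simp add: algebra_simps)
  then have "(p - c * q) * (1 - c\<^sup>2) = form v (simple_root a) * (1 - c\<^sup>2)"
    unfolding pq by (simp add: power2_eq_square algebra_simps)
  moreover have "(q - c * p) * (1 - c\<^sup>2) = q * (1 - c\<^sup>2) - c * (p * (1 - c\<^sup>2))"
    by (simp add: algebra_simps)
  then have "(q - c * p) * (1 - c\<^sup>2) = form v (simple_root b) * (1 - c\<^sup>2)"
    unfolding pq by (simp add: power2_eq_square algebra_simps)
  ultimately have "p - c * q = form v (simple_root a)" "q - c * p = form v (simple_root b)"
    using det by simp_all
  then have "act w x = x"
    by (intro fix_orthogonal)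
      (simp_all add: x_def form_linear forms form_simple_root_self mult.commute)
  then have "act w (x + p *\<^sub>R simple_root a + q *\<^sub>R simple_root b) =
      x + p *\<^sub>R simple_root a + q *\<^sub>R simple_root b"
    by (simp add: linear_add[OF linear_act] linear_scale[OF linear_act] fix_a fix_b)
  moreover have "x + p *\<^sub>R simple_root a + q *\<^sub>R simple_root b = v"
    by (simp add: x_def)
  ultimately have "act w v = v"
    by simp
  then show ?thesis by (simp add: w_def m_def)
qed


section \<open>Reduced words send simple roots to positive roots\<close>

lemma congruent_words_act: "u \<simeq> v \<Longrightarrow> act u x = act v x"
  by (induction arbitrary: x rule: cox_eq.induct)
    (simp_all add: act_append act_coxeter_relation)

lemma congruent_words_parity: "u \<simeq> v \<Longrightarrow> even (length u) \<longleftrightarrow> even (length v)"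
  by (induction rule: cox_eq.induct) (auto simp: alternating_even)

lemma congruent_words_rev: "u \<simeq> v \<Longrightarrow> rev u \<simeq> rev v"
proof (induction rule: cox_eq.induct)
  case (cox_rel a b)
  have "rev (concat (replicate m [a, b])) = concat (replicate m [b, a])" for m
    by (simp add: rev_concat)
  then show ?case
    using cox_eq.cox_rel[of W s b a] by (simp add: cox_ord_commute)
next
  case (cox_trans u v w)
  then show ?case by (metis cox_eq.cox_trans)
next
  case (cox_append u v u' v')
  then show ?case
    using cox_eq.cox_append[of W s "rev u'" "rev v'" "rev u" "rev v"] by simp
qed (simp_all add: cox_eq.cox_refl cox_eq.cox_sym)

lemma double_letter: "[a, a] \<simeq> []"
  using cox_eq.cox_rel[of W s a a] by (simp add: cox_ord_same)

lemma append_rev_congruent_Nil: "u @ rev u \<simeq> []"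
proof (induction u)
  case (Cons a u)
  have "[a] @ (u @ rev u) @ [a] \<simeq> [a] @ [] @ [a]"
    by (intro cox_append cox_refl Cons)
  then have "(a # u) @ rev (a # u) \<simeq> [a, a]"
    by simp
  then show ?case
    by (rule cox_trans[OF _ double_letter])
qed (simp add: cox_refl)

lemma congruent_rev_if_append_Nil:
  assumes "x @ y \<simeq> []"
  shows "y \<simeq> rev x"
proof -
  have "rev x @ x @ y \<simeq> rev x @ []"
    by (intro cox_append cox_refl assms)
  moreover have "(rev x @ x) @ y \<simeq> [] @ y"
    using append_rev_congruent_Nil[of "rev x"] by (intro cox_append cox_refl) simp
  then have "y \<simeq> rev x @ x @ y"
    by (simp add: cox_sym)
  ultimately show ?thesis
    using cox_trans by fastforce
qed

definition reduced_word :: "'n list \<Rightarrow> bool" where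
  "reduced_word u \<longleftrightarrow> (\<forall>v. u \<simeq> v \<longrightarrow> length u \<le> length v)"

lemma reduced_infix:
  assumes "reduced_word (p @ u @ q)"
  shows "reduced_word u"
  unfolding reduced_word_def
proof (intro allI impI)
  fix v
  assume "u \<simeq> v"
  then have "p @ u @ q \<simeq> p @ v @ q"
    by (intro cox_append cox_refl)
  with assms have "length (p @ u @ q) \<le> length (p @ v @ q)"
    unfolding reduced_word_def by blast
  then show "length u \<le> length v" by simp
qed

lemma reduced_rev:
  assumes "reduced_word u"
  shows "reduced_word (rev u)"
  using assms congruent_words_rev unfolding reduced_word_def by (metis length_rev rev_rev_ident)

lemma reduced_imp_distinct_adj:
  assumes "reduced_word u"
  shows "distinct_adj u"
  unfolding distinct_adj_conv_nth
proof (intro allI impI notI)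
  fix i
  assume i: "Suc i < length u" and "u ! i = u ! Suc i"
  then have "u = take i u @ [u ! i, u ! i] @ drop (i + 2) u"
    by (metis Cons_nth_drop_Suc Suc_lessD add_2_eq_Suc' append_Cons append_Nil append_take_drop_id)
  then have "reduced_word [u ! i, u ! i]"
    using assms reduced_infix by metis
  then show False
    using double_letter unfolding reduced_word_def by fastforce
qed

text \<open>
  A word like this contains the last \<open>m + 1\<close> of the \<open>2 m\<close> letters of the relation \<open>(b a)\<^sup>m = 1\<close>. The
  remaining \<open>m - 1\<close> letters, read backwards, are a shorter word for the same element.
\<close>

lemma long_alternating_not_reduced:
  assumes "cox_ord W s a b \<noteq> 0" "cox_ord W s a b < k"
  shows "\<not> reduced_word (alternating k a b)"
proof
  let ?m = "cox_ord W s a b"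
  assume red: "reduced_word (alternating k a b)"
  have "k = (k - Suc ?m) + Suc ?m"
    using assms by simp
  then obtain p where "alternating k a b = p @ alternating (Suc ?m) a b"
    using alternating_suffix by metis
  with red have red': "reduced_word (alternating (Suc ?m) a b)"
    using reduced_infix[of p _ "[]"] by simp
  have "2 * ?m = (?m - 1) + Suc ?m"
    using assms by simp
  then obtain z where z: "length z = ?m - 1" "alternating (2 * ?m) a b = z @ alternating (Suc ?m) a b"
    using alternating_suffix by metis
  have "alternating (2 * ?m) a b \<simeq> []"
    using cox_eq.cox_rel[of W s b a] by (simp add: alternating_even cox_ord_commute)
  then have "alternating (Suc ?m) a b \<simeq> rev z"
    using z(2) congruent_rev_if_append_Nil by simp
  with red' have "Suc ?m \<le> length (rev z)"
    unfolding reduced_word_def by (metis length_alternating)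
  then show False
    using z(1) by simp
qed

text \<open>
  The root that a reduced word attaches to its last letter is positive. Let the reduced word be
  \<open>u a\<close> and let \<open>b\<close> be the last letter of \<open>u\<close>. Among the factorizations of the element of \<open>u\<close> as \<open>v x\<close>
  with lengths adding up and \<open>x\<close> a word in \<open>a\<close> and \<open>b\<close>, take one with \<open>v\<close> as short as possible.
  Minimality makes \<open>v a\<close> and \<open>v b\<close> reduced, since otherwise \<open>v\<close> could give up a last letter to \<open>x\<close>; so
  \<open>v\<close> maps both simple roots to nonnegative vectors by induction. And \<open>x a\<close> is a reduced word in two
  letters, hence alternating and short, so that \<open>x\<close> maps the root of \<open>a\<close> to a nonnegative
  combination of the two simple roots.
\<close>

lemma reduced_snoc_root_nonneg:
  assumes "reduced_word (u @ [a])"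
  shows "0 \<le> act u (simple_root a) $ k"
  using assms
proof (induction "length u" arbitrary: u a rule: less_induct)
  case less
  note red = less.prems
  show ?case
  proof (cases u rule: rev_cases)
    case Nil
    then show ?thesis by (simp add: simple_root_def axis_def)
  next
    case (snoc u0 b)
    have ab: "a \<noteq> b"
      using reduced_imp_distinct_adj[OF red] snoc by (auto simp: distinct_adj_append_iff)
    have red_u: "reduced_word u"
      using reduced_infix[of "[]" u "[a]"] red by simp
    define factorization where "factorization = (\<lambda>(v, x).
      u \<simeq> v @ x \<and> length v + length x = length u \<and> set x \<subseteq> {a, b})"
    have start: "factorization (u0, [b])"
      using snoc by (simp add: factorization_def cox_refl)
    then obtain v x where vx: "factorization (v, x)"
      and least: "\<And>v' x'. factorization (v', x') \<Longrightarrow> length v \<le> length v'"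
      using ex_has_least_nat[of factorization "(u0, [b])" "\<lambda>z. length (fst z)"] by force
    have ux: "u \<simeq> v @ x" and len: "length v + length x = length u" and set_x: "set x \<subseteq> {a, b}"
      using vx by (auto simp: factorization_def)
    have shorter: "length v < length u"
      using least[OF start] snoc by simp
    have red_v: "reduced_word (v @ [c])" if c: "c \<in> {a, b}" for c
    proof (rule ccontr)
      assume "\<not> reduced_word (v @ [c])"
      then obtain v' where v': "v @ [c] \<simeq> v'" "length v' < length v + 1"
        by (auto simp: reduced_word_def not_le)
      have "length v' \<noteq> length v"
        using congruent_words_parity[OF v'(1)] by auto
      with v'(2) have lt: "length v' < length v" by simp
      have "v @ [] \<simeq> v @ [c, c]"
        by (intro cox_append cox_refl cox_sym[OF double_letter])
      moreover have "(v @ [c]) @ [c] \<simeq> v' @ [c]"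
        by (intro cox_append cox_refl v'(1))
      ultimately have "v \<simeq> v' @ [c]"
        using cox_trans[of W s v "v @ [c, c]"] by simp
      then have "v @ x \<simeq> (v' @ [c]) @ x"
        by (intro cox_append cox_refl)
      with ux have cong: "u \<simeq> v' @ (c # x)"
        using cox_trans[of W s u "v @ x"] by simp
      with red_u have "length u \<le> length (v' @ (c # x))"
        unfolding reduced_word_def by blast
      then have "factorization (v', c # x)"
        using cong lt len c set_x by (auto simp: factorization_def)
      from least[OF this] lt show False by simp
    qed
    have nonneg_v: "0 \<le> act v (simple_root c) $ k" if "c \<in> {a, b}" for c
      using less.hyps[OF shorter red_v[OF that]] .
    have cong: "u @ [a] \<simeq> (v @ x) @ [a]"
      by (intro cox_append cox_refl ux)
    have "reduced_word (v @ x @ [a])"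
      unfolding reduced_word_def
    proof (intro allI impI)
      fix y
      assume "v @ x @ [a] \<simeq> y"
      with cong have "u @ [a] \<simeq> y"
        using cox_trans[of W s "u @ [a]" "v @ x @ [a]"] by simp
      with red have "length (u @ [a]) \<le> length y"
        unfolding reduced_word_def by blast
      then show "length (v @ x @ [a]) \<le> length y"
        using len by simp
    qed
    then have red_x: "reduced_word (x @ [a])"
      using reduced_infix[of v "x @ [a]" "[]"] by simp
    then have x: "alternating (length x) b a = x"
      using distinct_adj_imp_alternating[OF _ set_x] reduced_imp_distinct_adj by blast
    then have "reduced_word (alternating (Suc (length x)) a b)"
      using red_x by simp
    then have "cox_ord W s a b = 0 \<or> length x < cox_ord W s a b"
      using long_alternating_not_reduced[of a b "Suc (length x)"] by fastforce
    then obtain c d where cd: "0 \<le> c" "0 \<le> d"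
      "act x (simple_root a) = c *\<^sub>R simple_root a + d *\<^sub>R simple_root b"
      using act_alternating_simple_root[OF ab] x by metis
    have "act u (simple_root a) = act v (act x (simple_root a))"
      using congruent_words_act[OF ux] by (simp add: act_append)
    also have "\<dots> = c *\<^sub>R act v (simple_root a) + d *\<^sub>R act v (simple_root b)"
      unfolding cd(3) by (simp add: linear_add[OF linear_act] linear_scale[OF linear_act])
    finally show ?thesis
      using cd(1,2) nonneg_v by simp
  qed
qed

lemma reduced_snoc_root_neq_uminus_simple_root:
  assumes "reduced_word (u @ [a])"
  shows "act u (simple_root a) \<noteq> - simple_root b"
proof
  assume "act u (simple_root a) = - simple_root b"
  with reduced_snoc_root_nonneg[OF assms, of b] show False
    by (simp add: simple_root_def axis_def)
qed

section \<open>Root functions under flips\<close>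

lemma nths_take_Suc:
  assumes "l < length xs"
  shows "nths (take (Suc l) xs) A = nths (take l xs) A @ (if l \<in> A then [xs ! l] else [])"
  using assms by (simp add: take_Suc_conv_app_nth nths_append)

lemma nths_take_cong:
  assumes "\<And>j. j < l \<Longrightarrow> j \<in> A \<longleftrightarrow> j \<in> B"
  shows "nths (take l xs) A = nths (take l xs) B"
  using assms
proof (induction l)
  case (Suc l)
  then show ?case
    by (cases "l < length xs") (simp_all add: nths_take_Suc)
qed simp

lemma nths_take_prefix:
  assumes "k \<le> l"
  shows "\<exists>u. nths (take l xs) A = nths (take k xs) A @ u"
proof -
  have "take l xs = take k xs @ take (l - k) (drop k xs)"
    using assms by (simp flip: take_add)
  then show ?thesis
    by (simp add: nths_append)
qed

lemma form_root_function: "form (root_function W s Q I l) (root_function W s Q I l) = 1"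
  by (simp add: root_function_def form_act form_simple_root_self)

lemma facet_subset:
  assumes "quadruple W s Q \<pi> I"
  shows "I \<subseteq> {..<length Q}"
proof -
  have "I \<in> subword_complex W s Q \<pi>"
    using assms by (simp add: quadruple_def)
  then show ?thesis
    by (simp add: subword_complex_def)
qed

lemma flippable_flatD:
  assumes "quadruple W s Q \<pi> I" "flippable_flat W s Q I i i'"
  shows "i \<in> I" "i < length Q" "i' \<notin> I" "i' < length Q"
  using assms(2) facet_subset[OF assms(1)] by (auto simp: flippable_flat_def)

text \<open>
  A facet is the complement of a reduced expression itself and not merely of a word containing
  one: a proper reduced subword would leave room for a larger face.
\<close>

lemma reduced_word_facet_complement:
  assumes "quadruple W s Q \<pi> I"
  shows "reduced_word (nths Q (- I))"
proof -
  have I: "I \<subseteq> {..<length Q}"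
    and maximal: "\<And>J. J \<in> subword_complex W s Q \<pi> \<Longrightarrow> I \<subseteq> J \<Longrightarrow> J = I"
    using facet_subset[OF assms] assms by (simp_all add: quadruple_def)
  obtain u where u: "subseq u (nths Q (- I))" "reduced_expression W s u \<pi>"
    using assms by (auto simp: quadruple_def subword_complex_def)
  obtain N where "u = nths (nths Q (- I)) N"
    using u(1) by (auto simp: subseq_conv_nths)
  then have "u = nths Q {k \<in> - I. \<exists>j\<in>N. card {k' \<in> - I. k' < k} = j}"
    by (simp add: nths_nths)
  then obtain B where B: "B \<subseteq> - I" "u = nths Q B"
    by (rule that[rotated]) auto
  define J where "J = {..<length Q} - B"
  have "nths Q (- J) = nths Q B"
    using nths_take_cong[of "length Q" "- J" B Q] by (auto simp: J_def)
  then have "J \<in> subword_complex W s Q \<pi>"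
    using u(2) B(2) by (auto simp: subword_complex_def J_def)
  moreover have "I \<subseteq> J"
    using I B(1) by (auto simp: J_def)
  ultimately have "J = I"
    using maximal by blast
  then have red: "reduced_expression W s (nths Q (- I)) \<pi>"
    using u(2) B(2) \<open>nths Q (- J) = nths Q B\<close> by simp
  show ?thesis
    unfolding reduced_word_def
  proof (intro allI impI)
    fix v
    assume "nths Q (- I) \<simeq> v"
    then have "word_prod W s (nths Q (- I)) = word_prod W s v"
      using coxeter_system by (simp add: coxeter_system_def)
    then have "word_prod W s v = \<pi>"
      using red by (simp add: reduced_expression_def)
    then have "cox_length W s \<pi> \<le> length v"
      unfolding cox_length_def by (intro Least_le) blast
    then show "length (nths Q (- I)) \<le> length v"
      using red by (simp add: reduced_expression_def)
  qed
qed

lemma act_insert_position: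
  assumes "p \<notin> C" "p < l" "l \<le> length Q"
  shows "act (nths (take l Q) (insert p C)) v =
    reflection_along (act (nths (take p Q) C) (simple_root (Q ! p))) (act (nths (take l Q) C) v)"
  using assms(2,3)
proof (induction l arbitrary: v)
  case (Suc l)
  show ?case
  proof (cases "l = p")
    case True
    have "nths (take p Q) (insert p C) = nths (take p Q) C"
      by (rule nths_take_cong) auto
    then show ?thesis
      using True Suc.prems assms(1) by (simp add: nths_take_Suc act_snoc)
  next
    case False
    then show ?thesis
      using Suc by (auto simp: nths_take_Suc act_append)
  qed
qed simp

text \<open>
  Both facets of a flip arise from their union by removing one position, so this lemma compares
  their root functions through the root function of the union.
\<close>

lemma root_function_remove:
  assumes "p \<in> K" "l < length Q"
  shows "root_function W s Q (K - {p}) l =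
    (if l \<le> p then root_function W s Q K l
     else reflection_along (root_function W s Q K p) (root_function W s Q K l))"
proof -
  have complement: "- (K - {p}) = insert p (- K)"
    using assms(1) by auto
  show ?thesis
  proof (cases "l \<le> p")
    case True
    then have "nths (take l Q) (- (K - {p})) = nths (take l Q) (- K)"
      by (intro nths_take_cong) auto
    with True show ?thesis
      by (simp add: root_function_def)
  next
    case False
    then show ?thesis
      using act_insert_position[of p "- K" l Q] assms by (simp add: root_function_def complement)
  qed
qed

text \<open>
  The two roots of a flippable flat are unit vectors on one line, and positivity of the roots of
  reduced words decides the sign. If \<open>i < i'\<close> and the roots were opposite, the letters of the
  reduced expression from \<open>i\<close> up to \<open>i'\<close> would form a reduced word whose last letter has a negative
  root. If \<open>i' < i\<close> and the roots were equal, the same would happen for the letters from \<open>i'\<close> up to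
  \<open>i\<close>, read backwards.
\<close>

lemma flippable_flat_roots:
  assumes red: "reduced_word (nths Q (- I))"
    and i: "i \<in> I" "i < length Q" and i': "i' \<notin> I" "i' < length Q"
    and line: "root_function W s Q I i' \<in> span {root_function W s Q I i}"
  shows "root_function W s Q I i' =
    (if i < i' then root_function W s Q I i else - root_function W s Q I i)"
proof -
  let ?r = "root_function W s Q I"
  let ?prefix = "\<lambda>l. nths (take l Q) (- I)"
  obtain c where c: "?r i' = c *\<^sub>R ?r i"
    using line by (auto simp: span_singleton)
  then have "c * c = 1"
    using form_root_function[of Q I i'] form_root_function[of Q I i] by (simp add: form_linear)
  then have "c = 1 \<or> c = -1"
    by (simp add: square_eq_1_iff)
  then have sign: "?r i' = ?r i \<or> ?r i' = - ?r i"
    using c by auto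
  have red_prefix: "reduced_word (?prefix l)" if l: "l \<le> length Q" for l
  proof -
    obtain z where "nths Q (- I) = ?prefix l @ z"
      using nths_take_prefix[OF l, of Q "- I"] by auto
    then show ?thesis
      using red reduced_infix[of "[]" "?prefix l" z] by simp
  qed
  show ?thesis
  proof (cases "i < i'")
    case True
    obtain u where u: "?prefix i' = ?prefix i @ u"
      using nths_take_prefix[of i i'] True by fastforce
    have "?prefix (Suc i') = ?prefix i @ u @ [Q ! i']"
      using i' u by (simp add: nths_take_Suc)
    then have red_u: "reduced_word (u @ [Q ! i'])"
      using red_prefix[of "Suc i'"] i'(2) reduced_infix[of "?prefix i" "u @ [Q ! i']" "[]"] by simp
    have "?r i' \<noteq> - ?r i"
    proof
      assume "?r i' = - ?r i"
      then have "act (?prefix i) (act u (simple_root (Q ! i'))) =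
          act (?prefix i) (- simple_root (Q ! i))"
        by (simp add: root_function_def u act_append linear_neg[OF linear_act])
      then have "act u (simple_root (Q ! i')) = - simple_root (Q ! i)"
        by (metis act_rev_cancel)
      then show False
        using reduced_snoc_root_neq_uminus_simple_root[OF red_u] by blast
    qed
    with sign True show ?thesis by simp
  next
    case False
    with i(1) i'(1) have lt: "i' < i"
      by (metis linorder_neqE_nat)
    let ?b = "Q ! i'"
    obtain u where "?prefix i = ?prefix (Suc i') @ u"
      using nths_take_prefix[of "Suc i'" i] lt by fastforce
    then have u: "?prefix i = ?prefix i' @ ?b # u"
      using i' by (simp add: nths_take_Suc)
    then have "reduced_word (?b # u)"
      using red_prefix[of i] i(2) reduced_infix[of "?prefix i'" "?b # u" "[]"] by simp
    then have red_u: "reduced_word (rev u @ [?b])"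
      using reduced_rev by fastforce
    have "?r i' \<noteq> ?r i"
    proof
      assume "?r i' = ?r i"
      then have "act (?prefix i') (simple_root ?b) =
          act (?prefix i') (act (?b # u) (simple_root (Q ! i)))"
        by (simp add: root_function_def u act_append)
      then have "act (?b # u) (simple_root (Q ! i)) = simple_root ?b"
        by (metis act_rev_cancel)
      then have "simple_root (Q ! i) = act (rev u) (act [?b] (simple_root ?b))"
        using act_rev_cancel[of "?b # u" "simple_root (Q ! i)"] by (simp add: act_append)
      also have "\<dots> = - act (rev u) (simple_root ?b)"
        by (simp add: act_singleton reflection_along_self form_simple_root_self
            linear_neg[OF linear_act])
      finally have "act (rev u) (simple_root ?b) = - simple_root (Q ! i)"
        by simp
      then show False
        using reduced_snoc_root_neq_uminus_simple_root[OF red_u] by blast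
    qed
    with sign False show ?thesis by simp
  qed
qed

text \<open>
  Replacing \<open>i\<close> by \<open>i'\<close> inserts one letter into the words behind the root function and deletes
  another. Both operations act as the reflection along the root \<open>\<beta>\<close> of \<open>i\<close>, so they cancel behind
  the later of the two positions.
\<close>

lemma flip_root_function:
  assumes quad: "quadruple W s Q \<pi> I"
    and flat: "flippable_flat W s Q I i i'"
  defines "\<beta> \<equiv> root_function W s Q I i"
  shows "l < length Q \<Longrightarrow> root_function W s Q (flip I i i') l =
      (if min i i' < l \<and> l \<le> max i i' then reflection_along \<beta> (root_function W s Q I l)
       else root_function W s Q I l)" (is "_ \<Longrightarrow> ?flipped l")
    and "root_function W s Q (flip I i i') i' = - \<beta>"
proof -
  have i: "i \<in> I" "i < length Q" and i': "i' \<notin> I" "i' < length Q"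
    using flippable_flatD[OF quad flat] by blast+
  have "i' \<in> flat W s Q I (span {\<beta>})"
    using flat by (simp add: flippable_flat_def \<beta>_def)
  then have "root_function W s Q I i' \<in> span {\<beta>}"
    by (simp add: flat_def)
  then have root_i': "root_function W s Q I i' = (if i < i' then \<beta> else - \<beta>)"
    using flippable_flat_roots[OF reduced_word_facet_complement[OF quad] i i'] by (simp add: \<beta>_def)
  have unit: "form \<beta> \<beta> = 1"
    by (simp add: \<beta>_def form_root_function)
  let ?K = "insert i' I"
  let ?R = "root_function W s Q ?K"
  have I: "I = ?K - {i'}" and J: "flip I i i' = ?K - {i}"
    using i i' by (auto simp: flip_def)
  have X: "root_function W s Q I k =
      (if k \<le> i' then ?R k else reflection_along (?R i') (?R k))" if "k < length Q" for k
    using root_function_remove[of i' ?K k Q] that I by simp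
  have Y: "root_function W s Q (flip I i i') k =
      (if k \<le> i then ?R k else reflection_along (?R i) (?R k))" if "k < length Q" for k
    using root_function_remove[of i ?K k Q] that J i(1) by simp
  have "?R i' = (if i < i' then \<beta> else - \<beta>)"
    using X[OF i'(2)] root_i' by simp
  then have refl_i': "reflection_along (?R i') = reflection_along \<beta>"
    by (simp add: reflection_along_uminus)
  have "?R i = (if i < i' then \<beta> else - \<beta>)"
  proof (cases "i \<le> i'")
    case True
    then show ?thesis
      using X[OF i(2)] i(1) i'(1) by (cases "i = i'") (auto simp: \<beta>_def)
  next
    case False
    then have "\<beta> = reflection_along \<beta> (?R i)"
      using X[OF i(2)] refl_i' by (simp add: \<beta>_def)
    then have "?R i = reflection_along \<beta> \<beta>"
      using reflection_along_involutive[OF unit] by metis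
    then show ?thesis
      using False reflection_along_self[OF unit] by simp
  qed
  then have refl_i: "reflection_along (?R i) = reflection_along \<beta>"
    by (simp add: reflection_along_uminus)
  have flipped: "?flipped k" if "k < length Q" for k
    using X[OF that] Y[OF that] reflection_along_involutive[OF unit]
    by (auto simp: refl_i refl_i' min_def max_def)
  then show "l < length Q \<Longrightarrow> ?flipped l" .
  show "root_function W s Q (flip I i i') i' = - \<beta>"
    using flipped[OF i'(2)] root_i' i(1) i'(1) reflection_along_self[OF unit]
    by (cases "i < i'") (auto simp: min_def max_def)
qed

text \<open>
  At a special vertex all neighbours are on one side, so the other roots of the facet on the
  opposite side are orthogonal to \<open>\<beta>\<close>, and it makes no difference to them whether the reflection
  is applied. Hence the flip can be described by the same map on both sides.
\<close>

lemma special_flip_root_function: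
  assumes quad: "quadruple W s Q \<pi> I"
    and flat: "flippable_flat W s Q I i i'"
    and special: "special_vertex W s Q I i i'"
  defines "\<beta> \<equiv> root_function W s Q I i"
  shows "(adjacent_vertices (root_quiver W s Q I) i \<subseteq> stable_interval Q i i' \<and>
       (\<forall>j\<in>I - {i}. root_function W s Q (flip I i i') j = root_function W s Q I j)) \<or>
    (adjacent_vertices (root_quiver W s Q I) i \<subseteq> reflection_interval i i' \<and>
       (\<forall>j\<in>I - {i}. root_function W s Q (flip I i i') j =
          reflection_along \<beta> (root_function W s Q I j)))"
proof -
  let ?N = "adjacent_vertices (root_quiver W s Q I) i"
  have i: "i \<in> I" and i': "i' \<notin> I" and I: "I \<subseteq> {..<length Q}"
    using flippable_flatD[OF quad flat] facet_subset[OF quad] by blast+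
  have fixed: "reflection_along \<beta> (root_function W s Q I j) = root_function W s Q I j"
    if "j \<in> I - {i}" "j \<notin> ?N" for j
  proof (rule reflection_along_orthogonal)
    have "\<not> 0 < (real i - real j) * form \<beta> (root_function W s Q I j)"
      "\<not> 0 < (real j - real i) * form \<beta> (root_function W s Q I j)"
      using that i form_commute[of \<beta> "root_function W s Q I j"]
      by (auto simp: adjacent_vertices_def root_quiver_def \<beta>_def)
    moreover have "real i - real j \<noteq> 0"
      using that by auto
    ultimately have "form \<beta> (root_function W s Q I j) = 0"
      by (auto simp: zero_less_mult_iff not_less)
    then show "form (root_function W s Q I j) \<beta> = 0"
      by (simp add: form_commute)
  qed
  have flipped: "root_function W s Q (flip I i i') j =
      (if j \<in> reflection_interval i i' then reflection_along \<beta> (root_function W s Q I j)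
       else root_function W s Q I j)" if "j \<in> I - {i}" for j
  proof -
    have "j < length Q" "j \<noteq> i" "j \<noteq> i'"
      using that I i' by auto
    then show ?thesis
      using flip_root_function(1)[OF quad flat, of j]
      by (auto simp: \<beta>_def reflection_interval_def min_def max_def)
  qed
  show ?thesis
  proof (cases "?N \<subseteq> stable_interval Q i i'")
    case True
    then have "root_function W s Q (flip I i i') j = root_function W s Q I j" if "j \<in> I - {i}" for j
      using flipped[OF that] fixed[OF that] by (auto simp: stable_interval_def)
    with True show ?thesis by blast
  next
    case False
    then have N: "?N \<subseteq> reflection_interval i i'"
      using special by (auto simp: special_vertex_def)
    have "root_function W s Q (flip I i i') j =
        reflection_along \<beta> (root_function W s Q I j)" if "j \<in> I - {i}" for j
      using flipped[OF that] fixed[OF that] N by (metis subsetD)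
    with N show ?thesis by blast
  qed
qed

end


section \<open>The effect of a flip on the root configuration quiver\<close>

theorem theorem3p28:
  fixes W :: "('g, 'b) monoid_scheme"
    and s :: "'n::finite \<Rightarrow> 'g"
    and Q :: "'n list"
    and \<pi> :: 'g
    and I :: "nat set"
    and i i' :: nat
  assumes "D_fin W s Q \<pi> I"
    and "longest_element W s \<pi>"
    and "flippable_flat W s Q I i i'"
    and "special_vertex W s Q I i i'"
  shows "root_quiver W s Q (flip I i i') =
    relabel (\<lambda>v. if v = i then i' else v) (reverse_arcs_at i (root_quiver W s Q I))"
proof -
  have quad: "quadruple W s Q \<pi> I"
    using assms(1) by (simp add: D_fin_def)
  interpret coxeter W s
    using quad by unfold_locales (simp add: quadruple_def)
  define \<sigma> where "\<sigma> = (\<lambda>v. if v = i then i' else v)"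
  define r where "r = root_function W s Q I"
  define r' where "r' = root_function W s Q (flip I i i')"
  define \<beta> where "\<beta> = r i"
  let ?X = "root_quiver W s Q I"
  let ?Y = "root_quiver W s Q (flip I i i')"
  have i: "i \<in> I" and i': "i' \<notin> I" and I: "I \<subseteq> {..<length Q}"
    using flippable_flatD[OF quad assms(3)] facet_subset[OF quad] by blast+
  have unit: "form \<beta> \<beta> = 1"
    by (simp add: \<beta>_def r_def form_root_function)
  have root_i': "r' i' = - \<beta>"
    using flip_root_function(2)[OF quad assms(3)] by (simp add: \<beta>_def r_def r'_def)
  have dichotomy: "(adjacent_vertices ?X i \<subseteq> stable_interval Q i i' \<and> (\<forall>j\<in>I - {i}. r' j = r j)) \<or>
    (adjacent_vertices ?X i \<subseteq> reflection_interval i i' \<and>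
       (\<forall>j\<in>I - {i}. r' j = reflection_along \<beta> (r j)))"
    using special_flip_root_function[OF quad assms(3,4)] by (simp add: \<beta>_def r_def r'_def)
  have form_away: "form (r' a) (r' b) = form (r a) (r b)" if "a \<in> I - {i}" "b \<in> I - {i}" for a b
    using dichotomy that form_reflection_along[OF unit] by auto
  \<comment> \<open>In the stable case the form value changes its sign and \<open>a\<close> lies on the same side of \<open>i\<close> and
    \<open>i'\<close>; in the reflected case the form value is kept and \<open>a\<close> lies between them.\<close>
  have at_i: "sgn ((real i' - real a) * form (r' i') (r' a)) =
      sgn ((real a - real i) * form (r i) (r a))"
    if a: "a \<in> I - {i}" for a
  proof (cases "a \<in> adjacent_vertices ?X i")
    case True
    have neq: "a \<noteq> i" "a \<noteq> i'"
      using a i' by auto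
    from dichotomy show ?thesis
    proof
      assume stable: "adjacent_vertices ?X i \<subseteq> stable_interval Q i i' \<and> (\<forall>j\<in>I - {i}. r' j = r j)"
      then have "form (r' i') (r' a) = - form (r i) (r a)"
        using a by (simp add: root_i' form_linear \<beta>_def)
      moreover have "(a < i \<and> a < i') \<or> (i < a \<and> i' < a)"
        using stable True neq
        by (auto simp: stable_interval_def reflection_interval_def min_def max_def split: if_splits)
      then have "sgn (real i' - real a) = - sgn (real a - real i)"
        by (auto simp: sgn_if)
      ultimately show ?thesis
        by (simp add: sgn_mult sgn_minus)
    next
      assume reflected: "adjacent_vertices ?X i \<subseteq> reflection_interval i i' \<and>
        (\<forall>j\<in>I - {i}. r' j = reflection_along \<beta> (r j))"
      then have "form (r' i') (r' a) = form (reflection_along \<beta> \<beta>) (reflection_along \<beta> (r a))"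
        using a by (simp add: root_i' reflection_along_self[OF unit])
      then have "form (r' i') (r' a) = form (r i) (r a)"
        unfolding form_reflection_along[OF unit] by (simp add: \<beta>_def)
      moreover have "(i < a \<and> a < i') \<or> (i' < a \<and> a < i)"
        using reflected True neq
        by (auto simp: reflection_interval_def min_def max_def split: if_splits)
      then have "sgn (real i' - real a) = sgn (real a - real i)"
        by (auto simp: sgn_if)
      ultimately show ?thesis
        by (simp add: sgn_mult)
    qed
  next
    case False
    have "\<not> 0 < (real i - real a) * form (r i) (r a)" "\<not> 0 < (real a - real i) * form (r i) (r a)"
      using False a i form_commute[of "r i" "r a"]
      by (auto simp: adjacent_vertices_def root_quiver_def r_def)
    moreover have "real i - real a \<noteq> 0"
      using a by auto
    ultimately have orthogonal: "form (r i) (r a) = 0"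
      by (auto simp: zero_less_mult_iff not_less)
    then have "reflection_along \<beta> (r a) = r a"
      by (simp add: \<beta>_def reflection_along_orthogonal form_commute)
    then have "form (r' i') (r' a) = 0"
      using dichotomy a orthogonal by (auto simp: root_i' form_linear \<beta>_def)
    with orthogonal show ?thesis by simp
  qed
  have at_i': "sgn ((real a - real i') * form (r' a) (r' i')) =
      sgn ((real i - real a) * form (r a) (r i))"
    if a: "a \<in> I - {i}" for a
    using at_i[OF a] form_commute[of "r a"] form_commute[of "r' a"]
    by (simp add: sgn_mult) (metis minus_diff_eq minus_mult_left sgn_minus)
  have pos_at_i: "0 < (real i' - real a) * form (r' i') (r' a) \<longleftrightarrow>
      0 < (real a - real i) * form (r i) (r a)" if "a \<in> I - {i}" for a
    using at_i[OF that] by (metis sgn_greater)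
  have pos_at_i': "0 < (real a - real i') * form (r' a) (r' i') \<longleftrightarrow>
      0 < (real i - real a) * form (r a) (r i)" if "a \<in> I - {i}" for a
    using at_i'[OF that] by (metis sgn_greater)
  have arcs: "(\<sigma> a, \<sigma> b) \<in> parcs ?Y \<longleftrightarrow> (a, b) \<in> parcs (reverse_arcs_at i ?X)"
    if ab: "a \<in> I" "b \<in> I" for a b
  proof -
    have vertices: "\<sigma> a \<in> flip I i i'" "\<sigma> b \<in> flip I i i'"
      using ab by (auto simp: \<sigma>_def flip_def)
    have arc_Y: "(\<sigma> a, \<sigma> b) \<in> parcs ?Y \<longleftrightarrow>
        0 < (real (\<sigma> a) - real (\<sigma> b)) * form (r' (\<sigma> a)) (r' (\<sigma> b))"
      using vertices by (simp add: root_quiver_def r'_def)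
    have arc_X: "(x, y) \<in> parcs ?X \<longleftrightarrow> 0 < (real x - real y) * form (r x) (r y)"
      if "x \<in> {a, b}" "y \<in> {a, b}" for x y
      using ab that by (auto simp: root_quiver_def r_def)
    consider "a = i" "b = i" | "a = i" "b \<noteq> i" | "a \<noteq> i" "b = i" | "a \<noteq> i" "b \<noteq> i"
      by blast
    then show ?thesis
    proof cases
      case 1
      then show ?thesis
        using arc_Y arc_X[of a b] by (simp add: reverse_arcs_at_def)
    next
      case 2
      then show ?thesis
        using arc_Y arc_X[of b a] pos_at_i[of b] ab
        by (simp add: reverse_arcs_at_def \<sigma>_def form_commute[of "r b" "r i"])
    next
      case 3
      then show ?thesis
        using arc_Y arc_X[of b a] pos_at_i'[of a] ab
        by (simp add: reverse_arcs_at_def \<sigma>_def form_commute[of "r i" "r a"])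
    next
      case 4
      then show ?thesis
        using arc_Y arc_X[of a b] ab by (simp add: reverse_arcs_at_def \<sigma>_def form_away)
    qed
  qed
  have vertices: "flip I i i' = \<sigma> ` I"
    using i by (auto simp: flip_def \<sigma>_def image_iff)
  have "parcs ?Y = map_prod \<sigma> \<sigma> ` parcs (reverse_arcs_at i ?X)"
  proof
    have "parcs ?Y \<subseteq> \<sigma> ` I \<times> \<sigma> ` I"
      unfolding vertices[symmetric] by (auto simp: root_quiver_def)
    then show "parcs ?Y \<subseteq> map_prod \<sigma> \<sigma> ` parcs (reverse_arcs_at i ?X)"
      using arcs by fastforce
  next
    have "parcs (reverse_arcs_at i ?X) \<subseteq> I \<times> I"
      by (auto simp: reverse_arcs_at_def root_quiver_def split: if_splits)
    then show "map_prod \<sigma> \<sigma> ` parcs (reverse_arcs_at i ?X) \<subseteq> parcs ?Y"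
      using arcs by fastforce
  qed
  moreover have "pverts ?Y = \<sigma> ` pverts (reverse_arcs_at i ?X)"
    by (simp add: root_quiver_def reverse_arcs_at_def vertices)
  ultimately have "?Y = relabel \<sigma> (reverse_arcs_at i ?X)"
    by (simp add: relabel_def)
  then show ?thesis
    by (simp add: \<sigma>_def)
qed

end
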